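(* For every positive integer $n$, the maximum number of copies of $C_6$ in an $n$-vertex bipartite graph containing no copy of $C_8$ is $6\binom{n-3}{3}$, i.e. \[ \mathrm{ex}_{bip}(n,C_6,C_8)=6\binom{n-3}{3}, \] and the only $n$-vertex $C_8$-free bipartite graph attaining this maximum is $K_{3,n-3}$.
   Context: $C_k$ denotes the cycle on $k$ vertices and $K_{a,b}$ the complete bipartite graph with parts of sizes $a$ and $b$. A copy of $H$ in $G$ is a (not necessarily induced) subgraph of $G$ isomorphic to $H$; $G$ is $F$-free if it contains no copy of $F$. $\mathrm{ex}_{bip}(n,H,F)$ denotes the maximum number of copies of $H$ over all $n$-vertex bipartite $F$-free graphs.
   Formalization: Uniqueness of K_{3,n-3} is stated only for n ≥ 6 and attainment for n ≥ 3: for n ≤ 2 this graph does not exist, and for 3 ≤ n ≤ 5 the maximum is 0 and other graphs also attain it; for n < 3 the binomial is read as 0. *)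

theory Defs
  imports Main "HOL-Library.Ramsey"
begin

type_synonym 'a graph = "'a set \<times> 'a set set"

abbreviation verts :: "'a graph \<Rightarrow> 'a set" where "verts \<equiv> fst"
abbreviation edges :: "'a graph \<Rightarrow> 'a set set" where "edges \<equiv> snd"

definition simple_graph :: "'a graph \<Rightarrow> bool" where
  "simple_graph G \<longleftrightarrow> finite (verts G) \<and> edges G \<subseteq> [verts G]\<^bsup>2\<^esup>"

definition subgraph :: "'a graph \<Rightarrow> 'a graph \<Rightarrow> bool" where
  "subgraph K G \<longleftrightarrow> simple_graph K \<and> verts K \<subseteq> verts G \<and> edges K \<subseteq> edges G"

definition graph_iso :: "'a graph \<Rightarrow> 'b graph \<Rightarrow> bool" where
  "graph_iso G H \<longleftrightarrow>
     (\<exists>f. bij_betw f (verts G) (verts H) \<and> edges H = (\<lambda>e. f ` e) ` edges G)"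

definition copies :: "'b graph \<Rightarrow> 'a graph \<Rightarrow> 'a graph set" where
  "copies H G = {K. subgraph K G \<and> graph_iso H K}"

definition num_copies :: "'b graph \<Rightarrow> 'a graph \<Rightarrow> nat" where
  "num_copies H G = card (copies H G)"

definition graph_free :: "'b graph \<Rightarrow> 'a graph \<Rightarrow> bool" where
  "graph_free F G \<longleftrightarrow> copies F G = {}"

definition bipartite :: "'a graph \<Rightarrow> bool" where
  "bipartite G \<longleftrightarrow>
     (\<exists>A B. A \<union> B = verts G \<and> A \<inter> B = {} \<and>
            (\<forall>e\<in>edges G. \<exists>a\<in>A. \<exists>b\<in>B. e = {a, b}))"

text \<open>The following is the cycle on \<open>k\<close> vertices only for \<open>k \<ge> 3\<close>.\<close>

definition cycle_graph :: "nat \<Rightarrow> nat graph" where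
  "cycle_graph k = ({..<k}, {{i, Suc i mod k} |i. i < k})"

definition complete_bipartite :: "nat \<Rightarrow> nat \<Rightarrow> (nat + nat) graph" where
  "complete_bipartite a b =
     ({..<a} <+> {..<b}, {{Inl i, Inr j} |i j. i < a \<and> j < b})"

definition bip_free_graph :: "nat \<Rightarrow> 'b graph \<Rightarrow> 'a graph \<Rightarrow> bool" where
  "bip_free_graph n F G \<longleftrightarrow>
     simple_graph G \<and> card (verts G) = n \<and> bipartite G \<and> graph_free F G"

text \<open>Every finite graph is isomorphic to one whose vertices are natural numbers, so the
  maximum may be taken over graphs of type \<^typ>\<open>nat graph\<close>. There are infinitely many such
  graphs on \<open>n\<close> vertices, but the set of values is finite (shown below), so \<^const>\<open>Max\<close>
  is meaningful whenever some \<open>n\<close>-vertex bipartite \<open>F\<close>-free graph exists.\<close>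

definition ex_bip :: "nat \<Rightarrow> 'b graph \<Rightarrow> 'c graph \<Rightarrow> nat" where
  "ex_bip n H F = Max {num_copies H G |G :: nat graph. bip_free_graph n F G}"

lemma copies_subset: "copies H G \<subseteq> Pow (verts G) \<times> Pow (Pow (verts G))"
  by (fastforce simp: copies_def subgraph_def simple_graph_def nsets_def)

lemma finite_copies: "simple_graph G \<Longrightarrow> finite (copies H G)"
  by (rule finite_subset[OF copies_subset]) (simp add: simple_graph_def)

lemma finite_num_copies_values:
  "finite {num_copies H G |G :: 'a graph. bip_free_graph n F G}"
proof (rule finite_subset)
  show "{num_copies H G |G :: 'a graph. bip_free_graph n F G} \<subseteq> {..2 ^ n * 2 ^ 2 ^ n}"
  proof
    fix m
    assume "m \<in> {num_copies H G |G :: 'a graph. bip_free_graph n F G}"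
    then obtain G :: "'a graph" where m: "m = num_copies H G" and "bip_free_graph n F G"
      by blast
    then have fin: "finite (verts G)" and n: "card (verts G) = n"
      by (auto simp: bip_free_graph_def simple_graph_def)
    have "num_copies H G \<le> card (Pow (verts G) \<times> Pow (Pow (verts G)))"
      unfolding num_copies_def by (rule card_mono[OF _ copies_subset]) (simp add: fin)
    also have "\<dots> = 2 ^ n * 2 ^ 2 ^ n"
      by (simp add: fin n card_Pow card_cartesian_product)
    finally show "m \<in> {..2 ^ n * 2 ^ 2 ^ n}" by (simp add: m)
  qed
qed simp

end

theory Submission
  imports Defs
begin

text \<open>
  Let \<open>G\<close> be bipartite and \<open>C\<^sub>8\<close>-free with parts \<open>X\<close>, \<open>Y\<close> of sizes \<open>p\<close>, \<open>q\<close>. A hexagon is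
  supported on a triple \<open>S \<subseteq> X\<close> and a triple \<open>T \<subseteq> Y\<close>, and a pair \<open>(S, T)\<close> supports at most \<open>6\<close>
  hexagons. Call \<open>S\<close> tight if only three vertices have two neighbours in \<open>S\<close>; a tight \<open>S\<close> determines \<open>T\<close>,
  hence lies in at most \<open>6\<close> hexagons, and likewise on the other side. If neither triple of a hexagon is
  tight, then \<open>C\<^sub>8\<close>-freeness forces it to be a ``broom'': it can be written \<open>x1 y1 x2 y2 x3 y3\<close> with a
  further common neighbour of \<open>x1\<close>, \<open>x2\<close> and a further common neighbour of \<open>y2\<close>, \<open>y3\<close>. The opposite pair
  \<open>(x3, y1)\<close> of a broom determines its vertex set, so there are at most \<open>2 p q\<close> brooms, and if there is a
  broom, then at least two triples on each side fail to be tight. For \<open>p, q \<ge> 4\<close> this gives at most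
  \<open>6 (p choose 3) + 6 (q choose 3)\<close> hexagons if there is no broom, and at most \<open>2 p q - 24\<close> more otherwise,
  both less than \<open>6 (p + q - 3 choose 3)\<close>. If \<open>p = 3\<close>, each of the \<open>q choose 3\<close> triples of \<open>Y\<close> contributes at most
  \<open>6\<close> hexagons, with equality for all of them only in the complete bipartite graph.
\<close>

text \<open>The shift by 3 keeps truncated subtraction out of the product, so the final comparison
  of binomials becomes one of polynomials over the naturals.\<close>

lemma six_choose_3: "6 * ((k + 3) choose 3) = (k + 3) * (k + 2) * (k + 1)"
proof -
  have "fact 3 * fact k * ((k + 3) choose 3) = (fact (k + 3) :: nat)"
    using binomial_fact_lemma[of 3 "k + 3"] by simp
  also have "\<dots> = fact k * ((k + 3) * (k + 2) * (k + 1))"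
    by (simp add: numeral_3_eq_3 algebra_simps)
  finally show ?thesis by (simp add: fact_numeral)
qed

section \<open>Cycles given by cyclic lists of vertices\<close>

definition cycle_of :: "'a list \<Rightarrow> 'a graph" where
  "cycle_of xs = (set xs, (\<lambda>i. {xs ! i, xs ! (Suc i mod length xs)}) ` {..<length xs})"

text \<open>An isomorphism from \<open>cycle_graph k\<close> is the same thing as an enumeration of
  the copy's vertices in cyclic order, so copies can be handled as explicit lists and the
  isomorphism never reappears.\<close>

lemma copies_cycle_graph_iff:
  assumes "simple_graph G"
  shows "K \<in> copies (cycle_graph k) G \<longleftrightarrow>
    (\<exists>xs. length xs = k \<and> distinct xs \<and> K = cycle_of xs \<and>
          set xs \<subseteq> verts G \<and> edges (cycle_of xs) \<subseteq> edges G)" (is "?L \<longleftrightarrow> ?R")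
proof
  assume ?L
  then have sub: "subgraph K G" and "graph_iso (cycle_graph k) K"
    by (auto simp: copies_def)
  then obtain f where f: "bij_betw f {..<k} (verts K)"
      "edges K = (`) f ` {{i, Suc i mod k} |i. i < k}"
    by (auto simp: graph_iso_def cycle_graph_def)
  let ?xs = "map f [0..<k]"
  have "distinct ?xs"
    using f(1) by (simp add: distinct_map bij_betw_def atLeast0LessThan)
  moreover have "K = cycle_of ?xs"
  proof (rule prod_eqI)
    show "verts K = verts (cycle_of ?xs)"
      using f(1) by (simp add: cycle_of_def bij_betw_def atLeast0LessThan)
    show "edges K = edges (cycle_of ?xs)"
      unfolding f(2) cycle_of_def by (auto simp: image_def)
  qed
  moreover from this have "set ?xs \<subseteq> verts G" "edges (cycle_of ?xs) \<subseteq> edges G"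
    using sub by (auto simp: subgraph_def cycle_of_def)
  ultimately show ?R
    by (intro exI[of _ ?xs]) auto
next
  assume ?R
  then obtain xs where xs: "length xs = k" "distinct xs" "K = cycle_of xs"
      "set xs \<subseteq> verts G" "edges (cycle_of xs) \<subseteq> edges G"
    by blast
  have "e \<in> [verts K]\<^bsup>2\<^esup>" if "e \<in> edges K" for e
  proof -
    have "e \<in> [verts G]\<^bsup>2\<^esup>"
      using that xs(3,5) assms by (auto simp: simple_graph_def)
    moreover have "e \<subseteq> set xs"
      using that xs(3) by (auto simp: cycle_of_def intro!: nth_mem mod_less_divisor)
    ultimately show ?thesis
      using xs(3) by (auto simp: nsets_def cycle_of_def)
  qed
  then have "subgraph K G"
    using xs by (auto simp: subgraph_def simple_graph_def cycle_of_def)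
  moreover have "graph_iso (cycle_graph k) K"
    unfolding graph_iso_def
  proof (intro exI conjI)
    show "bij_betw ((!) xs) (verts (cycle_graph k)) (verts K)"
      using xs by (auto simp: cycle_graph_def cycle_of_def bij_betw_nth)
    show "edges K = (`) ((!) xs) ` edges (cycle_graph k)"
      using xs by (auto simp: cycle_graph_def cycle_of_def image_def)
  qed
  ultimately show ?L by (simp add: copies_def)
qed

section \<open>Hexagons in a bipartite graph\<close>

definition hexagon :: "'a \<Rightarrow> 'a \<Rightarrow> 'a \<Rightarrow> 'a \<Rightarrow> 'a \<Rightarrow> 'a \<Rightarrow> 'a graph" where
  "hexagon x1 y1 x2 y2 x3 y3 =
     ({x1, x2, x3} \<union> {y1, y2, y3},
      {{x1, y1}, {y1, x2}, {x2, y2}, {y2, x3}, {x3, y3}, {y3, x1}})"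

lemma cycle_of_6: "cycle_of [x1, y1, x2, y2, x3, y3] = hexagon x1 y1 x2 y2 x3 y3"
  by (auto simp: cycle_of_def hexagon_def lessThan_Suc)

text \<open>Rotation by two places and reflection together realise all six orders of the
  \<open>x\<close> vertices; \<open>hexagon_dual\<close> is the shift by one place, which exchanges
  the two sides.\<close>

lemma hexagon_rotate: "hexagon x2 y2 x3 y3 x1 y1 = hexagon x1 y1 x2 y2 x3 y3"
  by (auto simp: hexagon_def)

lemma hexagon_reflect: "hexagon x2 y1 x1 y3 x3 y2 = hexagon x1 y1 x2 y2 x3 y3"
  by (auto simp: hexagon_def)

lemma hexagon_dual: "hexagon y1 x2 y2 x3 y3 x1 = hexagon x1 y1 x2 y2 x3 y3"
  by (auto simp: hexagon_def)

locale bip_graph =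
  fixes G :: "'a graph" and X Y :: "'a set"
  assumes simple: "simple_graph G"
    and verts_eq: "verts G = X \<union> Y"
    and disj: "X \<inter> Y = {}"
    and edges_XY: "\<And>e. e \<in> edges G \<Longrightarrow> \<exists>x\<in>X. \<exists>y\<in>Y. e = {x, y}"
begin

lemma finite_X: "finite X" and finite_Y: "finite Y"
  using simple verts_eq by (auto simp: simple_graph_def)

text \<open>Through this swap of the parts, each fact of the locale is also available for the other
  side; the \<open>_dual\<close> lemmas translate the notions.\<close>

lemma dual: "bip_graph G Y X"
  using simple verts_eq disj edges_XY by unfold_locales (auto, metis insert_commute)

definition adj :: "'a \<Rightarrow> 'a \<Rightarrow> bool" where
  "adj x y \<longleftrightarrow> x \<in> X \<and> y \<in> Y \<and> {x, y} \<in> edges G"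

lemma adj_dual: "bip_graph.adj G Y X y x \<longleftrightarrow> adj x y"
  using bip_graph.adj_def[OF dual] by (auto simp: adj_def insert_commute)

lemma adjD: "adj x y \<Longrightarrow> x \<in> X" "adj x y \<Longrightarrow> y \<in> Y"
  by (auto simp: adj_def)

lemma edge_X: "{x, y} \<in> edges G \<Longrightarrow> x \<in> X \<Longrightarrow> adj x y"
  using edges_XY[of "{x, y}"] disj by (auto simp: adj_def doubleton_eq_iff)

lemma edge_Y: "{y, x} \<in> edges G \<Longrightarrow> y \<in> Y \<Longrightarrow> adj x y"
  using edges_XY[of "{y, x}"] disj by (auto simp: adj_def doubleton_eq_iff insert_commute)

lemma edge_iff: "e \<in> edges G \<longleftrightarrow> (\<exists>x y. adj x y \<and> e = {x, y})"
  using edges_XY by (metis adj_def)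

definition hex :: "'a \<Rightarrow> 'a \<Rightarrow> 'a \<Rightarrow> 'a \<Rightarrow> 'a \<Rightarrow> 'a \<Rightarrow> bool" where
  "hex x1 y1 x2 y2 x3 y3 \<longleftrightarrow> distinct [x1, x2, x3] \<and> distinct [y1, y2, y3] \<and>
     adj x1 y1 \<and> adj x2 y1 \<and> adj x2 y2 \<and> adj x3 y2 \<and> adj x3 y3 \<and> adj x1 y3"

lemma hex_rotate: "hex x1 y1 x2 y2 x3 y3 \<Longrightarrow> hex x2 y2 x3 y3 x1 y1"
  by (auto simp: hex_def)

lemma hex_dual: "bip_graph.hex G Y X y1 x2 y2 x3 y3 x1 \<longleftrightarrow> hex x1 y1 x2 y2 x3 y3"
  unfolding bip_graph.hex_def[OF dual] hex_def adj_dual by auto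

lemma hex_mem:
  assumes "hex x1 y1 x2 y2 x3 y3"
  shows "x1 \<in> X" "x2 \<in> X" "x3 \<in> X" "y1 \<in> Y" "y2 \<in> Y" "y3 \<in> Y"
  using assms by (auto simp: hex_def adj_def)

definition hexes :: "'a graph set" where
  "hexes = copies (cycle_graph 6) G"

lemma finite_hexes: "finite hexes"
  unfolding hexes_def by (rule finite_copies[OF simple])

lemma hexes_iff:
  "K \<in> hexes \<longleftrightarrow> (\<exists>x1 y1 x2 y2 x3 y3. hex x1 y1 x2 y2 x3 y3 \<and> K = hexagon x1 y1 x2 y2 x3 y3)"
  (is "?L \<longleftrightarrow> ?R")
proof
  assume ?L
  then obtain xs where xs: "length xs = 6" "distinct xs" "K = cycle_of xs"
      "set xs \<subseteq> verts G" "edges (cycle_of xs) \<subseteq> edges G"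
    unfolding hexes_def copies_cycle_graph_iff[OF simple] by blast
  from xs(1) obtain a b c d e f where abc: "xs = [a, b, c, d, e, f]"
    by (auto simp: length_Suc_conv eval_nat_numeral)
  have edg: "{a, b} \<in> edges G" "{b, c} \<in> edges G" "{c, d} \<in> edges G" "{d, e} \<in> edges G"
      "{e, f} \<in> edges G" "{f, a} \<in> edges G"
    using xs(5) unfolding abc cycle_of_6 by (auto simp: hexagon_def)
  \<comment> \<open>\<open>hex\<close> starts on the \<open>X\<close> side, so a list that starts in
    \<open>Y\<close> is shifted by one place.\<close>
  consider "a \<in> X" | "a \<in> Y" using xs(4) verts_eq abc by auto
  then show ?R
  proof cases
    case 1
    then have "hex a b c d e f"
      using edg xs(2) edge_X edge_Y adjD unfolding hex_def abc
      by (metis distinct_length_2_or_more distinct_singleton)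
    then show ?thesis using xs(3) abc cycle_of_6 by metis
  next
    case 2
    then have "hex b c d e f a"
      using edg xs(2) edge_X edge_Y adjD unfolding hex_def abc
      by (metis distinct_length_2_or_more distinct_singleton)
    moreover have "K = hexagon b c d e f a"
      using xs(3) abc cycle_of_6 hexagon_dual by metis
    ultimately show ?thesis by blast
  qed
next
  assume ?R
  then obtain x1 y1 x2 y2 x3 y3 where h: "hex x1 y1 x2 y2 x3 y3" "K = hexagon x1 y1 x2 y2 x3 y3"
    by blast
  have "distinct [x1, y1, x2, y2, x3, y3]"
    using h(1) disj by (auto simp: hex_def adj_def)
  moreover have "set [x1, y1, x2, y2, x3, y3] \<subseteq> verts G"
    using hex_mem[OF h(1)] verts_eq by auto
  moreover have "edges (cycle_of [x1, y1, x2, y2, x3, y3]) \<subseteq> edges G"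
    using h(1) unfolding cycle_of_6 by (auto simp: hexagon_def hex_def adj_def insert_commute)
  ultimately show ?L
    using h(2) unfolding hexes_def copies_cycle_graph_iff[OF simple]
    by (intro exI[of _ "[x1, y1, x2, y2, x3, y3]"]) (simp add: cycle_of_6)
qed

lemma no_octagon:
  assumes free: "graph_free (cycle_graph 8) G"
    and "distinct [x1, x2, x3, x4]" "distinct [y1, y2, y3, y4]"
    and a: "adj x1 y1" "adj x2 y1" "adj x2 y2" "adj x3 y2" "adj x3 y3" "adj x4 y3" "adj x4 y4" "adj x1 y4"
  shows False
proof -
  let ?xs = "[x1, y1, x2, y2, x3, y3, x4, y4]"
  have "distinct ?xs"
    using assms disj by (auto simp: adj_def)
  moreover have "set ?xs \<subseteq> verts G"
    using a verts_eq by (auto simp: adj_def)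
  moreover have "edges (cycle_of ?xs) \<subseteq> edges G"
    using a by (auto simp: cycle_of_def adj_def lessThan_Suc insert_commute)
  ultimately have "cycle_of ?xs \<in> copies (cycle_graph 8) G"
    unfolding copies_cycle_graph_iff[OF simple] by (intro exI[of _ ?xs]) simp
  then show False using free by (auto simp: graph_free_def)
qed

text \<open>The vertices of an octagon alternate between the parts, so four of them lie in
  \<open>X\<close>.\<close>

lemma graph_free_octagon:
  assumes "card X < 4"
  shows "graph_free (cycle_graph 8) G"
proof (rule ccontr)
  assume "\<not> ?thesis"
  then obtain K where "K \<in> copies (cycle_graph 8) G" by (auto simp: graph_free_def)
  then obtain xs where xs: "length xs = 8" "distinct xs"
      "set xs \<subseteq> verts G" "edges (cycle_of xs) \<subseteq> edges G"
    unfolding copies_cycle_graph_iff[OF simple] by blast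
  from xs(1) obtain a b c d e f g h where abc: "xs = [a, b, c, d, e, f, g, h]"
    by (auto simp: length_Suc_conv eval_nat_numeral)
  have edg: "{a, b} \<in> edges G" "{b, c} \<in> edges G" "{c, d} \<in> edges G" "{d, e} \<in> edges G"
      "{e, f} \<in> edges G" "{f, g} \<in> edges G" "{g, h} \<in> edges G"
    using xs(4) unfolding abc cycle_of_def by (auto simp: lessThan_Suc)
  have "{a, c, e, g} \<subseteq> X \<or> {b, d, f, h} \<subseteq> X"
  proof (cases "a \<in> X")
    case True
    then show ?thesis using edg edge_X edge_Y adjD by (metis empty_subsetI insert_subset)
  next
    case False
    then have "a \<in> Y" using xs(3) abc verts_eq by auto
    then show ?thesis using edg edge_X edge_Y adjD by (metis empty_subsetI insert_subset)
  qed
  moreover have "card {a, c, e, g} = 4" "card {b, d, f, h} = 4"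
    using xs(2) unfolding abc by auto
  ultimately have "4 \<le> card X"
    using card_mono[OF finite_X] by metis
  then show False using assms by simp
qed

section \<open>Hexagons on a fixed pair of triples\<close>

lemma hexagon_parts:
  assumes "hex x1 y1 x2 y2 x3 y3"
  shows "verts (hexagon x1 y1 x2 y2 x3 y3) \<inter> X = {x1, x2, x3}"
    and "verts (hexagon x1 y1 x2 y2 x3 y3) \<inter> Y = {y1, y2, y3}"
  using hex_mem[OF assms] disj by (auto simp: hexagon_def)

definition hexes_on :: "'a set \<Rightarrow> 'a set \<Rightarrow> 'a graph set" where
  "hexes_on S T = {K \<in> hexes. verts K \<inter> X = S \<and> verts K \<inter> Y = T}"

lemma hexes_cards:
  assumes "K \<in> hexes"
  shows "verts K \<inter> X \<in> [X]\<^bsup>3\<^esup>" "verts K \<inter> Y \<in> [Y]\<^bsup>3\<^esup>"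
proof -
  from assms obtain x1 y1 x2 y2 x3 y3
    where h: "hex x1 y1 x2 y2 x3 y3" "K = hexagon x1 y1 x2 y2 x3 y3"
    unfolding hexes_iff by blast
  show "verts K \<inter> X \<in> [X]\<^bsup>3\<^esup>" "verts K \<inter> Y \<in> [Y]\<^bsup>3\<^esup>"
    using h(1) hex_mem[OF h(1)] unfolding h(2) hexagon_parts[OF h(1)]
    by (auto simp: nsets_def hex_def)
qed

text \<open>The order of the \<open>X\<close> vertices can be prescribed: each of the six orders is
  reached from \<open>x1\<close>, \<open>x2\<close>, \<open>x3\<close> by rotations and the
  reflection. What remains free is the order in which the \<open>Y\<close> vertices fill the
  gaps.\<close>

lemma hex_normalize:
  assumes "hex x1 y1 x2 y2 x3 y3" "{x1, x2, x3} = {a, b, c}"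
  obtains p q r where "{p, q, r} = {y1, y2, y3}" "hex a p b q c r"
    "hexagon a p b q c r = hexagon x1 y1 x2 y2 x3 y3"
proof -
  have "card {x1, x2, x3} = 3" using assms(1) by (auto simp: hex_def)
  then have "card {a, b, c} = 3" by (simp only: assms(2))
  then have "distinct [a, b, c]" by (auto simp: card_insert_if split: if_splits)
  moreover have "a \<in> {x1, x2, x3}" "b \<in> {x1, x2, x3}" "c \<in> {x1, x2, x3}"
    using assms(2) by auto
  ultimately consider "a = x1" "b = x2" "c = x3" | "a = x2" "b = x3" "c = x1"
    | "a = x3" "b = x1" "c = x2" | "a = x2" "b = x1" "c = x3"
    | "a = x1" "b = x3" "c = x2" | "a = x3" "b = x2" "c = x1"
    by auto
  then show thesis
  proof cases
    case 1
    show thesis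
    proof (rule that[of y1 y2 y3])
      show "{y1, y2, y3} = {y1, y2, y3}" by auto
      show "hex a y1 b y2 c y3" using assms(1) 1 by (auto simp: hex_def)
      show "hexagon a y1 b y2 c y3 = hexagon x1 y1 x2 y2 x3 y3" unfolding 1 by (rule refl)
    qed
  next
    case 2
    show thesis
    proof (rule that[of y2 y3 y1])
      show "{y2, y3, y1} = {y1, y2, y3}" by auto
      show "hex a y2 b y3 c y1" using assms(1) 2 by (auto simp: hex_def)
      show "hexagon a y2 b y3 c y1 = hexagon x1 y1 x2 y2 x3 y3"
        unfolding 2 by (rule hexagon_rotate)
    qed
  next
    case 3
    show thesis
    proof (rule that[of y3 y1 y2])
      show "{y3, y1, y2} = {y1, y2, y3}" by auto
      show "hex a y3 b y1 c y2" using assms(1) 3 by (auto simp: hex_def)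
      show "hexagon a y3 b y1 c y2 = hexagon x1 y1 x2 y2 x3 y3"
        unfolding 3 by (rule hexagon_rotate[symmetric])
    qed
  next
    case 4
    show thesis
    proof (rule that[of y1 y3 y2])
      show "{y1, y3, y2} = {y1, y2, y3}" by auto
      show "hex a y1 b y3 c y2" using assms(1) 4 by (auto simp: hex_def)
      show "hexagon a y1 b y3 c y2 = hexagon x1 y1 x2 y2 x3 y3"
        unfolding 4 by (rule hexagon_reflect)
    qed
  next
    case 5
    show thesis
    proof (rule that[of y3 y2 y1])
      show "{y3, y2, y1} = {y1, y2, y3}" by auto
      show "hex a y3 b y2 c y1" using assms(1) 5 by (auto simp: hex_def)
      show "hexagon a y3 b y2 c y1 = hexagon x1 y1 x2 y2 x3 y3"
        unfolding 5 by (rule trans[OF hexagon_rotate hexagon_reflect])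
    qed
  next
    case 6
    show thesis
    proof (rule that[of y2 y1 y3])
      show "{y2, y1, y3} = {y1, y2, y3}" by auto
      show "hex a y2 b y1 c y3" using assms(1) 6 by (auto simp: hex_def)
      show "hexagon a y2 b y1 c y3 = hexagon x1 y1 x2 y2 x3 y3"
        unfolding 6 by (rule trans[OF hexagon_rotate[symmetric] hexagon_reflect])
    qed
  qed
qed

lemma hexes_on_eq:
  assumes "distinct [a, b, c]"
  shows "hexes_on {a, b, c} T =
    (\<lambda>(p, q, r). hexagon a p b q c r) ` {(p, q, r). {p, q, r} = T \<and> hex a p b q c r}"
proof (intro set_eqI iffI)
  fix K assume K: "K \<in> hexes_on {a, b, c} T"
  then obtain x1 y1 x2 y2 x3 y3
    where h: "hex x1 y1 x2 y2 x3 y3" "K = hexagon x1 y1 x2 y2 x3 y3"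
    unfolding hexes_on_def hexes_iff by blast
  have "{x1, x2, x3} = {a, b, c}" "{y1, y2, y3} = T"
    using K hexagon_parts[OF h(1)] by (simp_all add: hexes_on_def h(2))
  with hex_normalize[OF h(1)] obtain p q r
    where "{p, q, r} = T" "hex a p b q c r" "K = hexagon a p b q c r"
    unfolding h(2) by metis
  then show "K \<in> (\<lambda>(p, q, r). hexagon a p b q c r) `
      {(p, q, r). {p, q, r} = T \<and> hex a p b q c r}"
    by force
next
  fix K assume "K \<in> (\<lambda>(p, q, r). hexagon a p b q c r) ` {(p, q, r). {p, q, r} = T \<and> hex a p b q c r}"
  then obtain p q r where h: "{p, q, r} = T" "hex a p b q c r" "K = hexagon a p b q c r"
    by auto
  then show "K \<in> hexes_on {a, b, c} T"
    using hexagon_parts[OF h(2)] unfolding hexes_on_def hexes_iff by blast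
qed

text \<open>Inside the hexagon \<open>p\<close> is the only common neighbour of \<open>a\<close> and
  \<open>b\<close>, \<open>q\<close> that of \<open>b\<close> and \<open>c\<close>, and
  \<open>r\<close> that of \<open>c\<close> and \<open>a\<close>; so the edge set recovers the
  order.\<close>

lemma hexagon_inj:
  assumes "hex a p b q c r" "hex a p' b q' c r'" "hexagon a p b q c r = hexagon a p' b q' c r'"
  shows "p = p' \<and> q = q' \<and> r = r'"
proof -
  have XY: "a \<in> X" "b \<in> X" "c \<in> X" "p \<in> Y" "q \<in> Y" "r \<in> Y" "p' \<in> Y" "q' \<in> Y" "r' \<in> Y"
    using hex_mem[OF assms(1)] hex_mem[OF assms(2)] by auto
  have d: "a \<noteq> b" "b \<noteq> c" "a \<noteq> c" "p \<noteq> q" "q \<noteq> r" "p \<noteq> r"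
    using assms(1) by (auto simp: hex_def)
  have E: "{u, v} \<in> edges (hexagon a p b q c r) \<longleftrightarrow>
      u = a \<and> (v = p \<or> v = r) \<or> u = b \<and> (v = p \<or> v = q) \<or> u = c \<and> (v = q \<or> v = r)"
    if "u \<in> X" "v \<in> Y" for u v
  proof -
    have "u \<noteq> p" "u \<noteq> q" "u \<noteq> r" "v \<noteq> a" "v \<noteq> b" "v \<noteq> c"
      using that XY disj by blast+
    then show ?thesis unfolding hexagon_def by (auto simp: doubleton_eq_iff)
  qed
  have "{{a, p'}, {b, p'}, {b, q'}, {c, q'}, {c, r'}, {a, r'}} \<subseteq> edges (hexagon a p b q c r)"
    unfolding assms(3) by (auto simp: hexagon_def insert_commute)
  then have "p' = p" "q' = q" "r' = r"
    using E XY d by auto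
  then show ?thesis by simp
qed

lemma inj_on_hexagon:
  "inj_on (\<lambda>(p, q, r). hexagon a p b q c r) {(p, q, r). {p, q, r} = T \<and> hex a p b q c r}"
  by (rule inj_onI) (clarsimp, metis hexagon_inj)

lemma orderings_3:
  assumes "distinct [d, e, f]"
  shows "{(p, q, r). {p, q, r} = {d, e, f}} =
    {(d, e, f), (d, f, e), (e, d, f), (e, f, d), (f, d, e), (f, e, d)}"
proof (intro set_eqI iffI)
  fix t assume t: "t \<in> {(p, q, r). {p, q, r} = {d, e, f}}"
  obtain p q r where pqr: "t = (p, q, r)" by (cases t)
  with t have eq: "{p, q, r} = {d, e, f}" by simp
  then have "card {p, q, r} = 3" using assms by auto
  then have "distinct [p, q, r]" by (auto simp: card_insert_if split: if_splits)
  moreover have "p \<in> {d, e, f}" "q \<in> {d, e, f}" "r \<in> {d, e, f}" using eq by auto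
  ultimately show "t \<in> {(d, e, f), (d, f, e), (e, d, f), (e, f, d), (f, d, e), (f, e, d)}"
    unfolding pqr by auto
qed auto

text \<open>With the order of \<open>S\<close> fixed, hexagons correspond to those of the six
  orderings of \<open>T\<close> for which all the required edges are present.\<close>

lemma card_hexes_on:
  assumes S: "S \<in> [X]\<^bsup>3\<^esup>" and T: "T \<in> [Y]\<^bsup>3\<^esup>"
  shows "card (hexes_on S T) \<le> 6"
    and "(\<And>x y. x \<in> S \<Longrightarrow> y \<in> T \<Longrightarrow> adj x y) \<Longrightarrow> card (hexes_on S T) = 6"
    and "x \<in> S \<Longrightarrow> y \<in> T \<Longrightarrow> \<not> adj x y \<Longrightarrow> card (hexes_on S T) < 6"
proof -
  from S obtain a b c where abc: "S = {a, b, c}" "distinct [a, b, c]"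
    by (auto simp: nsets_def card_3_iff)
  from T obtain d e f where def: "T = {d, e, f}" "distinct [d, e, f]"
    by (auto simp: nsets_def card_3_iff)
  let ?O = "{(p, q, r). {p, q, r} = T}"
  let ?P = "{(p, q, r). {p, q, r} = T \<and> hex a p b q c r}"
  have O: "?O = {(d, e, f), (d, f, e), (e, d, f), (e, f, d), (f, d, e), (f, e, d)}"
    unfolding def(1) by (rule orderings_3[OF def(2)])
  have cO: "card ?O = 6" "finite ?O"
    unfolding O using def(2) by auto
  have c: "card (hexes_on S T) = card ?P"
    unfolding abc(1) hexes_on_eq[OF abc(2)] by (rule card_image[OF inj_on_hexagon])
  have sub: "?P \<subseteq> ?O" by auto
  show "card (hexes_on S T) \<le> 6"
    using card_mono[OF cO(2) sub] cO(1) c by simp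
  show "card (hexes_on S T) = 6" if all: "\<And>x y. x \<in> S \<Longrightarrow> y \<in> T \<Longrightarrow> adj x y"
  proof -
    have "hex a p b q c r" if "(p, q, r) \<in> ?O" for p q r
    proof -
      have "distinct [p, q, r]" using that def(2) unfolding O by auto
      then show ?thesis using that all abc by (auto simp: hex_def)
    qed
    then have "?P = ?O" by auto
    then show ?thesis using c cO by simp
  qed
  show "card (hexes_on S T) < 6" if n: "x \<in> S" "y \<in> T" "\<not> adj x y"
  proof -
    have "?P \<noteq> ?O"
    proof
      assume "?P = ?O"
      \<comment> \<open>The three cyclic shifts of \<open>(d, e, f)\<close> together use all nine
        pairs between \<open>S\<close> and \<open>T\<close>, so a single non-adjacent pair excludes
        one of them.\<close>
      then have "{(d, e, f), (d, f, e), (e, d, f), (e, f, d), (f, d, e), (f, e, d)} \<subseteq> ?P"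
        unfolding O by simp
      then have "hex a d b e c f" "hex a e b f c d" "hex a f b d c e"
        by simp_all
      then show False
        using n unfolding abc(1) def(1) hex_def by auto
    qed
    then have "?P \<subset> ?O" using sub by blast
    then show ?thesis using psubset_card_mono[OF cO(2)] cO(1) c by simp
  qed
qed

section \<open>Tight triples and brooms\<close>

definition nb2 :: "'a set \<Rightarrow> 'a set" where
  "nb2 S = {y. \<exists>x\<in>S. \<exists>x'\<in>S. x \<noteq> x' \<and> adj x y \<and> adj x' y}"

lemma finite_nb2: "finite (nb2 S)"
  by (rule finite_subset[OF _ finite_Y]) (auto simp: nb2_def adj_def)

lemma nb2_dual: "bip_graph.nb2 G Y X T = {x. \<exists>y\<in>T. \<exists>y'\<in>T. y \<noteq> y' \<and> adj x y \<and> adj x y'}"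
  unfolding bip_graph.nb2_def[OF dual] adj_dual by simp

lemma hex_nb2:
  assumes "hex x1 y1 x2 y2 x3 y3"
  shows "{y1, y2, y3} \<subseteq> nb2 {x1, x2, x3}"
  using assms unfolding nb2_def hex_def by auto

text \<open>By \<open>hex_nb2\<close>, three is the least possible size of \<open>nb2 S\<close> when
  \<open>S\<close> is the \<open>X\<close> part of a hexagon.\<close>

definition tight :: "'a set set" where
  "tight = {S \<in> [X]\<^bsup>3\<^esup>. card (nb2 S) = 3}"

lemma finite_triples: "finite ([X]\<^bsup>3\<^esup>)"
  by (rule finite_imp_finite_nsets[OF finite_X])

lemma card_tight_le: "card tight \<le> card X choose 3"
proof -
  have "tight \<subseteq> [X]\<^bsup>3\<^esup>" by (auto simp: tight_def)
  from card_mono[OF finite_triples this] show ?thesis by simp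
qed

text \<open>The \<open>Y\<close> part of a hexagon on \<open>S\<close> has three elements and lies
  in \<open>nb2 S\<close>; if \<open>S\<close> is tight, the two sets coincide, which leaves one
  pair of triples per \<open>S\<close>.\<close>

lemma card_hexes_tight: "card {K \<in> hexes. verts K \<inter> X \<in> tight} \<le> 6 * card tight"
proof -
  have fin: "finite tight" by (rule finite_subset[OF _ finite_triples]) (auto simp: tight_def)
  have "{K \<in> hexes. verts K \<inter> X \<in> tight} \<subseteq> (\<Union>S\<in>tight. hexes_on S (nb2 S))"
  proof
    fix K assume K: "K \<in> {K \<in> hexes. verts K \<inter> X \<in> tight}"
    then obtain x1 y1 x2 y2 x3 y3
      where h: "hex x1 y1 x2 y2 x3 y3" "K = hexagon x1 y1 x2 y2 x3 y3"
      unfolding hexes_iff by blast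
    have "card {y1, y2, y3} = 3" using h(1) by (simp add: hex_def)
    moreover have "card (nb2 {x1, x2, x3}) = 3"
      using K hexagon_parts[OF h(1)] by (simp add: tight_def h(2))
    ultimately have "{y1, y2, y3} = nb2 {x1, x2, x3}"
      using card_subset_eq[OF finite_nb2 hex_nb2[OF h(1)]] by simp
    then show "K \<in> (\<Union>S\<in>tight. hexes_on S (nb2 S))"
      using K hexagon_parts[OF h(1)] by (auto simp: h(2) hexes_on_def)
  qed
  then have "card {K \<in> hexes. verts K \<inter> X \<in> tight} \<le> card (\<Union>S\<in>tight. hexes_on S (nb2 S))"
    by (rule card_mono[rotated]) (auto intro: finite_subset[OF _ finite_hexes] fin simp: hexes_on_def)
  also have "\<dots> \<le> (\<Sum>S\<in>tight. card (hexes_on S (nb2 S)))"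
    by (rule card_UN_le[OF fin])
  also have "\<dots> \<le> (\<Sum>S\<in>tight. 6)"
  proof (rule sum_mono)
    fix S assume "S \<in> tight"
    moreover have "nb2 S \<subseteq> Y" by (auto simp: nb2_def adj_def)
    ultimately have "S \<in> [X]\<^bsup>3\<^esup>" "nb2 S \<in> [Y]\<^bsup>3\<^esup>"
      by (simp_all add: tight_def nsets_def finite_nb2)
    then show "card (hexes_on S (nb2 S)) \<le> 6" by (rule card_hexes_on(1))
  qed
  finally show ?thesis by simp
qed

text \<open>The labelling singles out the opposite vertices \<open>y1\<close> and \<open>x3\<close>:
  \<open>x1\<close>, \<open>x2\<close> are the hexagon neighbours of \<open>y1\<close>, and
  \<open>y2\<close>, \<open>y3\<close> those of \<open>x3\<close>. Each of these two pairs has a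
  common neighbour outside the hexagon.\<close>

definition broom :: "'a \<Rightarrow> 'a \<Rightarrow> 'a \<Rightarrow> 'a \<Rightarrow> 'a \<Rightarrow> 'a \<Rightarrow> bool" where
  "broom x1 y1 x2 y2 x3 y3 \<longleftrightarrow> hex x1 y1 x2 y2 x3 y3 \<and>
     (\<exists>y. y \<notin> {y1, y2, y3} \<and> adj x1 y \<and> adj x2 y) \<and>
     (\<exists>x. x \<notin> {x1, x2, x3} \<and> adj x y2 \<and> adj x y3)"

text \<open>Seen from the other side, the opposite vertices \<open>x3\<close> and \<open>y1\<close>
  exchange roles, and so do the pairs \<open>x1\<close>, \<open>x2\<close> and \<open>y2\<close>,
  \<open>y3\<close>.\<close>

lemma broom_dual: "broom x1 y1 x2 y2 x3 y3 \<Longrightarrow> bip_graph.broom G Y X y2 x3 y3 x1 y1 x2"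
  unfolding broom_def bip_graph.broom_def[OF dual] adj_dual
  by (auto simp: bip_graph.hex_def[OF dual] hex_def adj_dual)

text \<open>Replacing \<open>x3\<close> by the extra vertex \<open>x\<close> gives a second hexagon
  on the same \<open>Y\<close> triple. In both hexagons the extra vertex \<open>y\<close> is a
  fourth member of \<open>nb2\<close> of the \<open>X\<close> triple.\<close>

lemma broom_not_tight:
  assumes "broom x1 y1 x2 y2 x3 y3"
  shows "card tight + 2 \<le> card X choose 3"
proof -
  from assms obtain x y where h: "hex x1 y1 x2 y2 x3 y3"
    and y: "y \<notin> {y1, y2, y3}" "adj x1 y" "adj x2 y"
    and x: "x \<notin> {x1, x2, x3}" "adj x y2" "adj x y3"
    by (auto simp: broom_def)
  have h': "hex x1 y1 x2 y2 x y3" using h x by (auto simp: hex_def)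
  have c4: "card {y, y1, y2, y3} = 4" using y h by (auto simp: hex_def)
  have nb: "card (nb2 {x1, x2, z}) \<noteq> 3" if "hex x1 y1 x2 y2 z y3" for z
  proof -
    have "{y, y1, y2, y3} \<subseteq> nb2 {x1, x2, z}"
      using hex_nb2[OF that] y that by (auto simp: nb2_def hex_def)
    from card_mono[OF finite_nb2 this] show ?thesis using c4 by linarith
  qed
  have mem: "{x1, x2, x3} \<in> [X]\<^bsup>3\<^esup>" "{x1, x2, x} \<in> [X]\<^bsup>3\<^esup>"
    using hex_mem[OF h] hex_mem[OF h'] h h' by (auto simp: nsets_def hex_def)
  have ne: "{x1, x2, x3} \<noteq> {x1, x2, x}" using x(1) by auto
  have "tight \<subseteq> [X]\<^bsup>3\<^esup> - {{x1, x2, x3}, {x1, x2, x}}"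
    using nb[OF h] nb[OF h'] by (auto simp: tight_def)
  then have "card tight \<le> card ([X]\<^bsup>3\<^esup> - {{x1, x2, x3}, {x1, x2, x}})"
    by (intro card_mono) (simp_all add: finite_triples)
  moreover have "card ([X]\<^bsup>3\<^esup> - {{x1, x2, x3}, {x1, x2, x}}) = card ([X]\<^bsup>3\<^esup>) - 2"
    using mem ne by (subst card_Diff_subset) auto
  moreover have "2 \<le> card ([X]\<^bsup>3\<^esup>)"
    using card_mono[OF finite_triples, of "{{x1, x2, x3}, {x1, x2, x}}"] mem ne by auto
  ultimately show ?thesis by simp
qed

text \<open>A path \<open>y1\<close>, \<open>u\<close>, \<open>v\<close>, \<open>x3\<close> whose
  \<open>u\<close> avoids \<open>x1\<close> and \<open>x2\<close> could be closed to an octagon with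
  the help of the detour \<open>x1\<close>, \<open>y\<close>, \<open>x2\<close>. The way back from
  \<open>x3\<close> depends on where \<open>v\<close> lies.\<close>

lemma broom_hub:
  assumes free: "graph_free (cycle_graph 8) G" and br: "broom x1 y1 x2 y2 x3 y3"
    and u: "adj u y1" "adj u v" "adj x3 v" "u \<noteq> x3" "v \<noteq> y1"
  shows "u \<in> {x1, x2}"
proof (rule ccontr)
  assume nu: "u \<notin> {x1, x2}"
  from br obtain x y where h: "hex x1 y1 x2 y2 x3 y3"
    and y: "y \<notin> {y1, y2, y3}" "adj x1 y" "adj x2 y"
    and x: "x \<notin> {x1, x2, x3}" "adj x y2" "adj x y3"
    by (auto simp: broom_def)
  note facts = h[unfolded hex_def] y x u nu
  consider "v = y3" | "v = y2" | "v = y" | "v \<notin> {y2, y3, y}" by blast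
  then show False
  proof cases
    case 1
    then show False using facts by (intro no_octagon[OF free, of x2 x1 u x3 y y1 y3 y2]) auto
  next
    case 2
    then show False using facts by (intro no_octagon[OF free, of x1 x2 u x3 y y1 y2 y3]) auto
  next
    case 3
    \<comment> \<open>Here \<open>x3\<close> itself is adjacent to \<open>y\<close>, and the octagon
      avoids \<open>u\<close>, passing through the extra vertex \<open>x\<close> instead.\<close>
    then show False using facts by (intro no_octagon[OF free, of x1 x2 x x3 y1 y2 y3 y]) auto
  next
    case 4
    then show False using facts by (intro no_octagon[OF free, of x1 x2 u x3 y y1 v y3]) auto
  qed
qed

lemma broom_hubs:
  assumes free: "graph_free (cycle_graph 8) G" and br: "broom x1 y1 x2 y2 x3 y3"
    and h: "hex u1 y1 u2 v2 x3 v3"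
  shows "{u1, u2} = {x1, x2}"
proof -
  have "u1 \<in> {x1, x2}"
    using h by (intro broom_hub[OF free br, of _ v3]) (auto simp: hex_def)
  moreover have "u2 \<in> {x1, x2}"
    using h by (intro broom_hub[OF free br, of _ v2]) (auto simp: hex_def)
  moreover have "u1 \<noteq> u2" using h by (simp add: hex_def)
  ultimately show ?thesis by auto
qed

definition brooms :: "'a graph set" where
  "brooms = {hexagon x1 y1 x2 y2 x3 y3 | x1 y1 x2 y2 x3 y3. broom x1 y1 x2 y2 x3 y3}"

text \<open>Fix the opposite vertices. By \<open>broom_hubs\<close> and its dual, all brooms with
  these share both the pair \<open>x1\<close>, \<open>x2\<close> and the pair \<open>y2\<close>,
  \<open>y3\<close>; only the matching of the two pairs is free, which gives two hexagons.\<close>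

lemma card_brooms:
  assumes free: "graph_free (cycle_graph 8) G"
  shows "card brooms \<le> 2 * (card X * card Y)"
proof -
  define B where "B = (\<lambda>(x, y). {hexagon x1 y x2 y2 x y3 | x1 x2 y2 y3. broom x1 y x2 y2 x y3})"
  have cB: "card (B t) \<le> 2" for t
  proof (cases "B t = {}")
    case False
    obtain x y where t: "t = (x, y)" by force
    from False obtain x1 x2 y2 y3 where br: "broom x1 y x2 y2 x y3"
      by (auto simp: B_def t)
    have "B t \<subseteq> {hexagon x1 y x2 y2 x y3, hexagon x1 y x2 y3 x y2}"
    proof
      fix K assume "K \<in> B t"
      then obtain u1 u2 v2 v3 where b: "broom u1 y u2 v2 x v3" and K: "K = hexagon u1 y u2 v2 x v3"
        by (auto simp: B_def t)
      have h: "hex u1 y u2 v2 x v3" using b by (simp add: broom_def)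
      then have u: "{u1, u2} = {x1, x2}" by (rule broom_hubs[OF free br])
      have "bip_graph.hex G Y X v2 x v3 u1 y u2"
        using h by (auto simp: bip_graph.hex_def[OF dual] hex_def adj_dual)
      then have v: "{v2, v3} = {y2, y3}"
        by (rule bip_graph.broom_hubs[OF dual free broom_dual[OF br]])
      \<comment> \<open>The four ways to order the two pairs give only two hexagons, since
        reflection swaps both pairs at once.\<close>
      show "K \<in> {hexagon x1 y x2 y2 x y3, hexagon x1 y x2 y3 x y2}"
        using u v hexagon_reflect[of x2 y x1 y3 x y2] hexagon_reflect[of x2 y x1 y2 x y3]
        unfolding K doubleton_eq_iff by auto
    qed
    then have "card (B t) \<le> card {hexagon x1 y x2 y2 x y3, hexagon x1 y x2 y3 x y2}"
      by (rule card_mono[rotated]) simp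
    also have "\<dots> \<le> 2" by (simp add: card_insert_if)
    finally show ?thesis .
  qed simp
  have fin: "finite (X \<times> Y)" using finite_X finite_Y by simp
  have sub: "brooms \<subseteq> (\<Union>t\<in>X \<times> Y. B t)"
  proof
    fix K assume "K \<in> brooms"
    then obtain x1 y1 x2 y2 x3 y3
      where b: "broom x1 y1 x2 y2 x3 y3" "K = hexagon x1 y1 x2 y2 x3 y3"
      by (auto simp: brooms_def)
    then have "x3 \<in> X" "y1 \<in> Y" using hex_mem by (auto simp: broom_def)
    moreover have "K \<in> B (x3, y1)" using b unfolding B_def by blast
    ultimately show "K \<in> (\<Union>t\<in>X \<times> Y. B t)" by blast
  qed
  have "B t \<subseteq> hexes" for t
    unfolding B_def hexes_iff subset_iff broom_def by (cases t) blast
  then have "card brooms \<le> card (\<Union>t\<in>X \<times> Y. B t)"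
    using sub by (intro card_mono) (auto intro: finite_subset[OF _ finite_hexes] simp: finite_X finite_Y)
  also have "\<dots> \<le> (\<Sum>t\<in>X \<times> Y. card (B t))" by (rule card_UN_le[OF fin])
  also have "\<dots> \<le> (\<Sum>t\<in>X \<times> Y. 2)" by (rule sum_mono) (rule cB)
  finally show ?thesis by (simp add: card_cartesian_product)
qed

text \<open>If neither triple is tight, each side has an extra vertex joined to two vertices of the
  hexagon. Rotate so that the extra \<open>y\<close> sees \<open>x1\<close> and \<open>x2\<close>.
  If the extra \<open>x\<close> sees \<open>y2\<close> and \<open>y3\<close>, this is a broom; if it
  sees \<open>y1\<close> and one of the others, both extra vertices can be inserted into the
  hexagon, making an octagon.\<close>

lemma hexes_cases:
  assumes free: "graph_free (cycle_graph 8) G" and K: "K \<in> hexes"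
  shows "verts K \<inter> X \<in> tight \<or> verts K \<inter> Y \<in> bip_graph.tight G Y X \<or> K \<in> brooms"
proof (rule ccontr)
  assume neg: "\<not> ?thesis"
  from K obtain a d b e c f
    where h: "hex a d b e c f" "K = hexagon a d b e c f"
    unfolding hexes_iff by blast
  have hd: "bip_graph.hex G Y X d b e c f a" using h(1) by (simp add: hex_dual)
  have "card (nb2 {a, b, c}) \<noteq> 3" "card (bip_graph.nb2 G Y X {d, e, f}) \<noteq> 3"
    using neg hexes_cards[OF K] hexagon_parts[OF h(1)]
    by (auto simp: tight_def bip_graph.tight_def[OF dual] h(2))
  moreover have "card {a, b, c} = 3" "card {d, e, f} = 3" using h(1) by (auto simp: hex_def)
  ultimately have "nb2 {a, b, c} \<noteq> {d, e, f}" "bip_graph.nb2 G Y X {d, e, f} \<noteq> {a, b, c}"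
    by metis+
  moreover have "{a, b, c} \<subseteq> bip_graph.nb2 G Y X {d, e, f}"
    using bip_graph.hex_nb2[OF dual hd] by (simp add: insert_commute)
  ultimately obtain y x where y: "y \<in> nb2 {a, b, c}" "y \<notin> {d, e, f}"
    and x: "x \<in> bip_graph.nb2 G Y X {d, e, f}" "x \<notin> {a, b, c}"
    using hex_nb2[OF h(1)] by blast
  obtain x1 y1 x2 y2 x3 y3 where g: "hex x1 y1 x2 y2 x3 y3" "K = hexagon x1 y1 x2 y2 x3 y3"
      "{x1, x2, x3} = {a, b, c}" "{y1, y2, y3} = {d, e, f}" "adj x1 y" "adj x2 y"
  proof -
    from y(1) consider "adj a y" "adj b y" | "adj b y" "adj c y" | "adj c y" "adj a y"
      by (auto simp: nb2_def)
    then show thesis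
    proof cases
      case 1
      show thesis by (rule that[OF h refl refl 1])
    next
      case 2
      have "K = hexagon b e c f a d" unfolding h(2) by (rule hexagon_rotate[symmetric])
      then show thesis by (rule that[OF hex_rotate[OF h(1)] _ _ _ 2]) auto
    next
      case 3
      have "K = hexagon c f a d b e" unfolding h(2) by (rule hexagon_rotate)
      then show thesis by (rule that[OF hex_rotate[OF hex_rotate[OF h(1)]] _ _ _ 3]) auto
    qed
  qed
  have x': "x \<notin> {x1, x2, x3}" and y': "y \<notin> {y1, y2, y3}" using x y g by auto
  note facts = g(1)[unfolded hex_def] g(5,6) x' y'
  from x(1) consider "adj x y2" "adj x y3" | "adj x y1" "adj x y2" | "adj x y1" "adj x y3"
    unfolding g(4)[symmetric] nb2_dual by auto
  then show False
  proof cases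
    case 1
    then have "broom x1 y1 x2 y2 x3 y3" using g x' y' by (auto simp: broom_def)
    then show False using neg g(2) by (auto simp: brooms_def)
  next
    case 2
    then show False using facts by (intro no_octagon[OF free, of x1 x2 x x3 y y1 y2 y3]) auto
  next
    case 3
    then show False using facts by (intro no_octagon[OF free, of x2 x1 x x3 y y1 y3 y2]) auto
  qed
qed

section \<open>The number of hexagons\<close>

lemma hexes_empty:
  assumes "card X < 3"
  shows "hexes = {}"
proof -
  have False if "K \<in> hexes" for K
  proof -
    have "card (verts K \<inter> X) = 3" using hexes_cards(1)[OF that] by (simp add: nsets_def)
    moreover have "card (verts K \<inter> X) \<le> card X" by (rule card_mono[OF finite_X]) simp
    ultimately show False using assms by simp
  qed
  then show ?thesis by blast
qed

lemma card_hexes_split: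
  assumes "card X = 3"
  shows "card hexes = (\<Sum>T\<in>[Y]\<^bsup>3\<^esup>. card (hexes_on X T))"
proof -
  have "hexes = (\<Union>T\<in>[Y]\<^bsup>3\<^esup>. hexes_on X T)"
  proof (intro set_eqI iffI)
    fix K assume K: "K \<in> hexes"
    have "verts K \<inter> X = X"
      using hexes_cards(1)[OF K] assms by (intro card_subset_eq[OF finite_X]) (auto simp: nsets_def)
    then show "K \<in> (\<Union>T\<in>[Y]\<^bsup>3\<^esup>. hexes_on X T)"
      using K hexes_cards(2)[OF K] by (auto simp: hexes_on_def)
  qed (auto simp: hexes_on_def)
  moreover have "card (\<Union>T\<in>[Y]\<^bsup>3\<^esup>. hexes_on X T) = (\<Sum>T\<in>[Y]\<^bsup>3\<^esup>. card (hexes_on X T))"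
    by (rule card_UN_disjoint)
      (auto simp: hexes_on_def finite_hexes intro!: finite_imp_finite_nsets finite_Y)
  ultimately show ?thesis by simp
qed

text \<open>\<open>X\<close> is the only possible \<open>X\<close> triple, so the count is a sum
  over the triples of \<open>Y\<close> with terms at most 6.\<close>

lemma card_hexes_3:
  assumes X: "card X = 3"
  shows "card hexes \<le> 6 * (card Y choose 3)"
    and "(\<And>x y. x \<in> X \<Longrightarrow> y \<in> Y \<Longrightarrow> adj x y) \<Longrightarrow> card hexes = 6 * (card Y choose 3)"
    and "x \<in> X \<Longrightarrow> y \<in> Y \<Longrightarrow> \<not> adj x y \<Longrightarrow> 3 \<le> card Y \<Longrightarrow> card hexes < 6 * (card Y choose 3)"
proof -
  have XX: "X \<in> [X]\<^bsup>3\<^esup>" using X finite_X by (simp add: nsets_def)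
  have six: "(\<Sum>T\<in>[Y]\<^bsup>3\<^esup>. 6) = 6 * (card Y choose 3)"
    by (simp add: card_nsets)
  note le = card_hexes_on(1)[OF XX]
  show "card hexes \<le> 6 * (card Y choose 3)"
    unfolding card_hexes_split[OF X] six[symmetric] by (rule sum_mono) (rule le)
  show "card hexes = 6 * (card Y choose 3)" if "\<And>x y. x \<in> X \<Longrightarrow> y \<in> Y \<Longrightarrow> adj x y"
    unfolding card_hexes_split[OF X] six[symmetric]
  proof (rule sum.cong[OF refl])
    fix T assume "T \<in> [Y]\<^bsup>3\<^esup>"
    then show "card (hexes_on X T) = 6"
      using that by (intro card_hexes_on(2)[OF XX]) (auto simp: nsets_def)
  qed
  show "card hexes < 6 * (card Y choose 3)" if n: "x \<in> X" "y \<in> Y" "\<not> adj x y" "3 \<le> card Y"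
  proof -
    \<comment> \<open>The vertex \<open>y\<close> of a missing edge is completed to a triple, whose
      term is then strictly below 6.\<close>
    have "2 \<le> card (Y - {y})" using n by simp
    then obtain U where U: "U \<subseteq> Y - {y}" "card U = 2" "finite U"
      by (meson obtain_subset_with_card_n)
    then have T: "insert y U \<in> [Y]\<^bsup>3\<^esup>"
      using n(2) by (auto simp: nsets_def card_insert_if)
    have "card (hexes_on X (insert y U)) < 6"
      by (rule card_hexes_on(3)[OF XX T n(1) _ n(3)]) simp
    then show ?thesis
      unfolding card_hexes_split[OF X] six[symmetric]
      using le T by (intro sum_strict_mono_ex1) (auto intro: finite_imp_finite_nsets finite_Y)
  qed
qed

lemma card_hexes_bound:
  assumes free: "graph_free (cycle_graph 8) G"
  shows "card hexes \<le> 6 * card tight + 6 * card (bip_graph.tight G Y X) + card brooms"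
proof -
  have sub: "hexes \<subseteq> {K \<in> hexes. verts K \<inter> X \<in> tight} \<union>
      {K \<in> hexes. verts K \<inter> Y \<in> bip_graph.tight G Y X} \<union> brooms"
    using hexes_cases[OF free] by blast
  have "brooms \<subseteq> hexes" unfolding brooms_def broom_def hexes_iff subset_iff by blast
  then have "finite brooms" using finite_hexes finite_subset by blast
  then have "card hexes \<le> card ({K \<in> hexes. verts K \<inter> X \<in> tight} \<union>
      {K \<in> hexes. verts K \<inter> Y \<in> bip_graph.tight G Y X} \<union> brooms)"
    using sub finite_hexes by (intro card_mono) auto
  also have "\<dots> \<le> card {K \<in> hexes. verts K \<inter> X \<in> tight} +
      card {K \<in> hexes. verts K \<inter> Y \<in> bip_graph.tight G Y X} + card brooms"
    by (meson add_le_mono card_Un_le le_refl le_trans)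
  also have "\<dots> \<le> 6 * card tight + 6 * card (bip_graph.tight G Y X) + card brooms"
    using card_hexes_tight bip_graph.card_hexes_tight[OF dual]
    by linarith
  finally show ?thesis .
qed

lemma card_hexes_ge_4:
  assumes free: "graph_free (cycle_graph 8) G" and X: "4 \<le> card X" and Y: "4 \<le> card Y"
  shows "card hexes < 6 * ((card X + card Y - 3) choose 3)"
proof -
  obtain i j where i: "card X = i + 4" and j: "card Y = j + 4"
    using X Y by (metis add.commute le_Suc_ex)
  have cX: "6 * (card X choose 3) = (i + 4) * (i + 3) * (i + 2)"
    and cY: "6 * (card Y choose 3) = (j + 4) * (j + 3) * (j + 2)"
    using six_choose_3[of "i + 1"] six_choose_3[of "j + 1"] i j by (simp_all add: algebra_simps)
  have cn: "6 * ((card X + card Y - 3) choose 3) = (i + j + 5) * (i + j + 4) * (i + j + 3)"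
    using six_choose_3[of "i + j + 2"] i j by (simp add: algebra_simps)
  note bound = card_hexes_bound[OF free]
  \<comment> \<open>After expansion each right side exceeds its left side by a polynomial with
    positive coefficients. The 24 is 6 times the four triples, two on each side, that a broom keeps
    from being tight; without it the second inequality fails at \<open>i = j = 0\<close>.\<close>
  have polys: "(i + 4) * (i + 3) * (i + 2) + (j + 4) * (j + 3) * (j + 2) <
      (i + j + 5) * (i + j + 4) * (i + j + 3)"
    "(i + 4) * (i + 3) * (i + 2) + (j + 4) * (j + 3) * (j + 2) + 2 * ((i + 4) * (j + 4)) <
      (i + j + 5) * (i + j + 4) * (i + j + 3) + 24"
    by (simp_all add: algebra_simps)
  show ?thesis
  proof (cases "brooms = {}")
    case True
    then have "card hexes \<le> 6 * (card X choose 3) + 6 * (card Y choose 3)"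
      using bound card_tight_le bip_graph.card_tight_le[OF dual] by simp
    then show ?thesis using polys(1) unfolding cX cY cn by linarith
  next
    case False
    then obtain x1 y1 x2 y2 x3 y3 where br: "broom x1 y1 x2 y2 x3 y3"
      by (auto simp: brooms_def)
    have "card tight + 2 \<le> card X choose 3" by (rule broom_not_tight[OF br])
    moreover have "card (bip_graph.tight G Y X) + 2 \<le> card Y choose 3"
      by (rule bip_graph.broom_not_tight[OF dual broom_dual[OF br]])
    moreover have "card brooms \<le> 2 * ((i + 4) * (j + 4))"
      using card_brooms[OF free] i j by simp
    ultimately have "card hexes + 24 \<le> 6 * (card X choose 3) + 6 * (card Y choose 3) +
        2 * ((i + 4) * (j + 4))"
      using bound by linarith
    then show ?thesis using polys(2) unfolding cX cY cn by linarith
  qed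
qed

lemma card_hexes_le:
  assumes free: "graph_free (cycle_graph 8) G"
  shows "card hexes \<le> 6 * ((card X + card Y - 3) choose 3)"
proof -
  consider "card X < 3" | "card Y < 3" | "card X = 3" | "card Y = 3" | "4 \<le> card X" "4 \<le> card Y"
    by linarith
  then show ?thesis
  proof cases
    case 1
    then show ?thesis using hexes_empty by simp
  next
    case 2
    then show ?thesis using bip_graph.hexes_empty[OF dual] by simp
  next
    case 3
    then show ?thesis using card_hexes_3(1) by simp
  next
    case 4
    then show ?thesis using bip_graph.card_hexes_3(1)[OF dual] by simp
  next
    case 5
    then show ?thesis using card_hexes_ge_4[OF free] by simp
  qed
qed

lemma card_hexes_extremal:
  assumes free: "graph_free (cycle_graph 8) G" and n: "6 \<le> card X + card Y"
    and eq: "card hexes = 6 * ((card X + card Y - 3) choose 3)"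
  shows "(card X = 3 \<or> card Y = 3) \<and> (\<forall>x\<in>X. \<forall>y\<in>Y. adj x y)"
proof -
  \<comment> \<open>A positive target rules out a side with fewer than three vertices, where there
    are no hexagons.\<close>
  have pos: "0 < (card X + card Y - 3) choose 3" using n by simp
  then have ge3: "3 \<le> card X" "3 \<le> card Y"
    using eq hexes_empty bip_graph.hexes_empty[OF dual]
    by (metis card.empty linorder_not_le mult_is_0 zero_neq_numeral not_less_zero)+
  have "card X = 3 \<or> card Y = 3"
    using card_hexes_ge_4[OF free] eq ge3 by linarith
  moreover have "adj x y" if "x \<in> X" "y \<in> Y" for x y
    using calculation
  proof
    assume "card X = 3"
    then show ?thesis using card_hexes_3(3)[OF _ that] ge3 eq by fastforce
  next
    assume "card Y = 3"
    then show ?thesis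
      using bip_graph.card_hexes_3(3)[OF dual _ that(2,1)] ge3 eq
      unfolding adj_dual by fastforce
  qed
  ultimately show ?thesis by blast
qed

end

lemma bipartite_bip_graph:
  assumes "simple_graph G" "bipartite G"
  obtains X Y where "bip_graph G X Y"
  using assms unfolding bipartite_def bip_graph_def by metis

lemma bip_graph_card:
  assumes "bip_graph G X Y"
  shows "card (verts G) = card X + card Y"
  using bip_graph.finite_X[OF assms] bip_graph.finite_Y[OF assms] assms
  by (simp add: bip_graph_def card_Un_disjoint)

lemma bip_graph_bipartite:
  assumes "bip_graph G X Y"
  shows "bipartite G"
  using assms unfolding bipartite_def bip_graph_def by metis

section \<open>Complete bipartite graphs\<close>

text \<open>Complete bipartite graph on prescribed parts of any vertex type, so that extremal graphs
  can be treated as equalities and the isomorphism is needed only in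
  \<open>graph_iso_complete_bipartite_iff\<close>.\<close>

definition join :: "'a set \<Rightarrow> 'a set \<Rightarrow> 'a graph" where
  "join X Y = (X \<union> Y, {{x, y} |x y. x \<in> X \<and> y \<in> Y})"

lemma join_commute: "join Y X = join X Y"
proof (rule prod_eqI)
  show "verts (join Y X) = verts (join X Y)" by (simp add: join_def Un_commute)
  have "{y, x} = {x, y}" for x y :: 'a by (rule insert_commute)
  then show "edges (join Y X) = edges (join X Y)"
    unfolding join_def snd_conv by (metis (no_types, lifting))
qed

lemma bip_graph_join:
  assumes "finite X" "finite Y" "X \<inter> Y = {}"
  shows "bip_graph (join X Y) X Y"
proof
  have "card {x, y} = 2" if "x \<in> X" "y \<in> Y" for x y
    using that assms(3) by (auto simp: card_insert_if)
  then show "simple_graph (join X Y)"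
    using assms(1,2) by (auto simp: simple_graph_def join_def nsets_def)
qed (use assms in \<open>auto simp: join_def\<close>)

lemma join_extremal:
  assumes "finite X" "finite Y" "X \<inter> Y = {}" "card X = 3"
  shows "bip_free_graph (3 + card Y) (cycle_graph 8) (join X Y)"
    and "num_copies (cycle_graph 6) (join X Y) = 6 * (card Y choose 3)"
proof -
  interpret bip_graph "join X Y" X Y by (rule bip_graph_join[OF assms(1-3)])
  have "adj x y" if "x \<in> X" "y \<in> Y" for x y
    using that unfolding adj_def by (auto simp: join_def)
  then show "num_copies (cycle_graph 6) (join X Y) = 6 * (card Y choose 3)"
    using card_hexes_3(2)[OF assms(4)] by (simp add: num_copies_def hexes_def)
  show "bip_free_graph (3 + card Y) (cycle_graph 8) (join X Y)"
    using simple graph_free_octagon assms(4) bip_graph_card[OF bip_graph_axioms]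
      bip_graph_bipartite[OF bip_graph_axioms]
    by (simp add: bip_free_graph_def)
qed

lemma complete_bipartite_join:
  "complete_bipartite a b = join (Inl ` {..<a}) (Inr ` {..<b})"
  by (auto simp: complete_bipartite_def join_def Plus_def)

lemma graph_iso_complete_bipartite_iff:
  assumes "simple_graph G"
  shows "graph_iso G (complete_bipartite a b) \<longleftrightarrow>
    (\<exists>X Y. finite X \<and> finite Y \<and> X \<inter> Y = {} \<and> card X = a \<and> card Y = b \<and> G = join X Y)"
    (is "?L \<longleftrightarrow> ?R")
proof
  assume ?L
  then obtain f where f: "bij_betw f (verts G) (Inl ` {..<a} \<union> Inr ` {..<b})"
    and e: "{{Inl i, Inr j} |i j. i < a \<and> j < b} = (`) f ` edges G"
    by (auto simp: graph_iso_def complete_bipartite_def Plus_def)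
  \<comment> \<open>The parts of \<open>G\<close> are the preimages of the two summands; the inverse
    \<open>g\<close> carries the standard edges back.\<close>
  define g where "g = inv_into (verts G) f"
  have g: "bij_betw g (Inl ` {..<a} \<union> Inr ` {..<b}) (verts G)"
    unfolding g_def by (rule bij_betw_inv_into[OF f])
  have gf: "g ` f ` A = A" if "A \<subseteq> verts G" for A
    using that f unfolding g_def bij_betw_def by (metis inv_into_image_cancel)
  have edge_sub: "A \<subseteq> verts G" if "A \<in> edges G" for A
    using that assms by (auto simp: simple_graph_def nsets_def)
  have "edges G = (`) g ` (`) f ` edges G"
    using gf edge_sub by (force simp: image_image)
  also have "\<dots> = {{g (Inl i), g (Inr j)} |i j. i < a \<and> j < b}"
    unfolding e[symmetric] by (auto simp: image_def)
  finally have eg: "edges G = {{g (Inl i), g (Inr j)} |i j. i < a \<and> j < b}" .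
  define X where "X = g ` Inl ` {..<a}"
  define Y where "Y = g ` Inr ` {..<b}"
  have inj: "inj_on g (Inl ` {..<a} \<union> Inr ` {..<b})" using g by (simp add: bij_betw_def)
  have "X \<inter> Y = {}"
    unfolding X_def Y_def using inj by (subst inj_on_image_Int[symmetric, OF inj]) auto
  moreover have "card X = a" "card Y = b"
    unfolding X_def Y_def using inj_on_subset[OF inj]
    by (simp_all add: card_image)
  moreover have "G = join X Y"
  proof (rule prod_eqI)
    show "verts G = verts (join X Y)"
      using g by (auto simp: join_def X_def Y_def bij_betw_def image_Un)
    show "edges G = edges (join X Y)"
      unfolding eg by (auto simp: join_def X_def Y_def)
  qed
  ultimately show ?R by (intro exI[of _ X] exI[of _ Y]) (simp add: X_def Y_def)
next
  assume ?R
  then obtain X Y where XY: "finite X" "finite Y" "X \<inter> Y = {}" "card X = a" "card Y = b"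
      "G = join X Y"
    by blast
  obtain p q where p: "bij_betw p X {..<a}" and q: "bij_betw q Y {..<b}"
    using XY by (metis ex_bij_betw_finite_nat atLeast0LessThan)
  define f where "f v = (if v \<in> X then Inl (p v) else Inr (q v))" for v
  have "bij_betw f (X \<union> Y) (Inl ` {..<a} \<union> Inr ` {..<b})"
  proof (rule bij_betw_combine)
    have "bij_betw (Inl \<circ> p) X (Inl ` {..<a})"
      by (rule bij_betw_trans[OF p]) (simp add: bij_betw_def)
    then show "bij_betw f X (Inl ` {..<a})"
      by (rule bij_betw_cong[THEN iffD1, rotated]) (simp add: f_def)
    have "bij_betw (Inr \<circ> q) Y (Inr ` {..<b})"
      by (rule bij_betw_trans[OF q]) (simp add: bij_betw_def)
    then show "bij_betw f Y (Inr ` {..<b})"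
      by (rule bij_betw_cong[THEN iffD1, rotated]) (use XY(3) in \<open>auto simp: f_def\<close>)
  qed auto
  moreover have "{{Inl i, Inr j} |i j. i < a \<and> j < b} = (`) f ` {{x, y} |x y. x \<in> X \<and> y \<in> Y}"
  proof (intro set_eqI iffI)
    fix e assume "e \<in> {{Inl i, Inr j} |i j. i < a \<and> j < b}"
    then obtain i j where ij: "i < a" "j < b" and e: "e = {Inl i, Inr j}" by blast
    have "i \<in> p ` X" "j \<in> q ` Y" using ij p q by (simp_all add: bij_betw_def)
    then obtain x y where xy: "x \<in> X" "p x = i" "y \<in> Y" "q y = j" by blast
    then have "e = f ` {x, y}" using e XY(3) by (auto simp: f_def)
    then show "e \<in> (`) f ` {{x, y} |x y. x \<in> X \<and> y \<in> Y}" using xy by blast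
  next
    fix e assume "e \<in> (`) f ` {{x, y} |x y. x \<in> X \<and> y \<in> Y}"
    then obtain x y where xy: "x \<in> X" "y \<in> Y" "e = f ` {x, y}" by blast
    then have "e = {Inl (p x), Inr (q y)}" using XY(3) by (auto simp: f_def)
    moreover have "p x < a" "q y < b" using xy p q by (auto simp: bij_betw_def)
    ultimately show "e \<in> {{Inl i, Inr j} |i j. i < a \<and> j < b}" by blast
  qed
  ultimately show ?L
    unfolding graph_iso_def complete_bipartite_def Plus_def XY(6) join_def by auto
qed

section \<open>The extremal number and the extremal graphs\<close>

lemma num_copies_hexagon_le:
  assumes "bip_free_graph n (cycle_graph 8) G"
  shows "num_copies (cycle_graph 6) G \<le> 6 * ((n - 3) choose 3)"
proof -
  from assms obtain X Y where b: "bip_graph G X Y"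
    by (auto simp: bip_free_graph_def elim: bipartite_bip_graph)
  interpret bip_graph G X Y by (rule b)
  show ?thesis
    using card_hexes_le bip_graph_card[OF b] assms
    by (auto simp: bip_free_graph_def num_copies_def hexes_def)
qed

lemma ex_bip_hexagon_octagon:
  "ex_bip n (cycle_graph 6) (cycle_graph 8) = 6 * ((n - 3) choose 3)"
proof -
  let ?V = "{num_copies (cycle_graph 6) G |G :: nat graph. bip_free_graph n (cycle_graph 8) G}"
  have le: "m \<le> 6 * ((n - 3) choose 3)" if "m \<in> ?V" for m
    using that num_copies_hexagon_le by blast
  have "6 * ((n - 3) choose 3) \<in> ?V"
  proof (cases "3 \<le> n")
    case True
    let ?G = "join {..<3} {3..<n}"
    have "{..<3} \<inter> {3..<n} = {}" by auto
    from join_extremal[OF _ _ this] True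
    have "bip_free_graph n (cycle_graph 8) ?G"
      "num_copies (cycle_graph 6) ?G = 6 * ((n - 3) choose 3)"
      by simp_all
    then show ?thesis by (metis (mono_tags, lifting) mem_Collect_eq)
  next
    case False
    \<comment> \<open>For \<open>n < 3\<close> the truncated \<open>n - 3\<close> is 0 and so is the
      bound; the edgeless graph on \<open>n\<close> vertices attains it.\<close>
    let ?G = "join {} {..<n}"
    interpret bip_graph ?G "{}" "{..<n}" by (rule bip_graph_join) auto
    have "bip_free_graph n (cycle_graph 8) ?G"
      using simple graph_free_octagon bip_graph_card[OF bip_graph_axioms]
        bip_graph_bipartite[OF bip_graph_axioms]
      by (simp add: bip_free_graph_def)
    moreover have "num_copies (cycle_graph 6) ?G = 0"
      using hexes_empty by (simp add: num_copies_def hexes_def)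
    moreover have "6 * ((n - 3) choose 3) = 0" using False by simp
    ultimately show ?thesis by (metis (mono_tags, lifting) mem_Collect_eq)
  qed
  with le show ?thesis
    unfolding ex_bip_def by (intro Max_eqI finite_num_copies_values) auto
qed

text \<open>Below 6 vertices the value is 0, attained already by edgeless graphs; from 6 on it is
  positive and forces the structure through \<open>card_hexes_extremal\<close>.\<close>

lemma extremal_iff:
  assumes n: "6 \<le> n" and G: "bip_free_graph n (cycle_graph 8) G"
  shows "num_copies (cycle_graph 6) G = 6 * ((n - 3) choose 3) \<longleftrightarrow>
    graph_iso G (complete_bipartite 3 (n - 3))"
proof -
  have simple: "simple_graph G" using G by (simp add: bip_free_graph_def)
  show ?thesis
  proof
    assume eq: "num_copies (cycle_graph 6) G = 6 * ((n - 3) choose 3)"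
    from G obtain X Y where b: "bip_graph G X Y"
      by (auto simp: bip_free_graph_def elim: bipartite_bip_graph)
    interpret bip_graph G X Y by (rule b)
    have card: "card X + card Y = n" and free: "graph_free (cycle_graph 8) G"
      using G bip_graph_card[OF b] by (auto simp: bip_free_graph_def)
    have ext: "card X = 3 \<or> card Y = 3" "\<forall>x\<in>X. \<forall>y\<in>Y. adj x y"
      using card_hexes_extremal[OF free] n eq by (simp_all add: card num_copies_def hexes_def)
    have "G = join X Y"
    proof (rule prod_eqI)
      show "verts G = verts (join X Y)" by (simp add: verts_eq join_def)
      have "adj x y \<longleftrightarrow> x \<in> X \<and> y \<in> Y" for x y
        using ext(2) adjD by blast
      then have "e \<in> edges G \<longleftrightarrow> (\<exists>x y. (x \<in> X \<and> y \<in> Y) \<and> e = {x, y})" for e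
        by (simp add: edge_iff)
      then show "edges G = edges (join X Y)"
        unfolding join_def by (simp add: set_eq_iff) blast
    qed
    \<comment> \<open>Either part may be the one of size three; \<open>join_commute\<close> lets it
      be listed first.\<close>
    then have "\<exists>X' Y'. finite X' \<and> finite Y' \<and> X' \<inter> Y' = {} \<and> card X' = 3 \<and>
        card Y' = n - 3 \<and> G = join X' Y'"
      using ext(1)
    proof (elim disjE)
      assume "card X = 3"
      then show ?thesis
        using card finite_X finite_Y disj \<open>G = join X Y\<close>
        by (intro exI[of _ X] exI[of _ Y]) simp
    next
      assume "card Y = 3"
      then show ?thesis
        using card finite_X finite_Y disj \<open>G = join X Y\<close> join_commute[of X Y]
        by (intro exI[of _ Y] exI[of _ X]) (simp add: Int_commute)
    qed
    then show "graph_iso G (complete_bipartite 3 (n - 3))"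
      by (simp only: graph_iso_complete_bipartite_iff[OF simple])
  next
    assume "graph_iso G (complete_bipartite 3 (n - 3))"
    then obtain X Y where "finite X" "finite Y" "X \<inter> Y = {}" "card X = 3" "card Y = n - 3"
        "G = join X Y"
      by (auto simp only: graph_iso_complete_bipartite_iff[OF simple])
    then show "num_copies (cycle_graph 6) G = 6 * ((n - 3) choose 3)"
      using join_extremal(2)[of X Y] by simp
  qed
qed

theorem theorem2:
  fixes n :: nat
  assumes "n \<ge> 1"
  shows "ex_bip n (cycle_graph 6) (cycle_graph 8) = 6 * ((n - 3) choose 3) \<and>
    (n \<ge> 3 \<longrightarrow>
      bip_free_graph n (cycle_graph 8) (complete_bipartite 3 (n - 3)) \<and>
      num_copies (cycle_graph 6) (complete_bipartite 3 (n - 3))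
        = ex_bip n (cycle_graph 6) (cycle_graph 8)) \<and>
    (n \<ge> 6 \<longrightarrow>
      (\<forall>G :: 'a graph. bip_free_graph n (cycle_graph 8) G \<longrightarrow>
        (num_copies (cycle_graph 6) G = ex_bip n (cycle_graph 6) (cycle_graph 8)
          \<longleftrightarrow> graph_iso G (complete_bipartite 3 (n - 3)))))"
proof (intro conjI impI allI)
  show "ex_bip n (cycle_graph 6) (cycle_graph 8) = 6 * ((n - 3) choose 3)"
    by (rule ex_bip_hexagon_octagon)
  show "bip_free_graph n (cycle_graph 8) (complete_bipartite 3 (n - 3))"
    "num_copies (cycle_graph 6) (complete_bipartite 3 (n - 3))
      = ex_bip n (cycle_graph 6) (cycle_graph 8)" if "3 \<le> n"
  proof -
    \<comment> \<open>\<open>complete_bipartite\<close> is itself a \<open>join\<close>, of the two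
      tagged intervals, so \<open>join_extremal\<close> applies to it directly.\<close>
    have "(Inl ` {..<3} :: (nat + nat) set) \<inter> Inr ` {..<n - 3} = {}" by auto
    from join_extremal[OF _ _ this] that
    show "bip_free_graph n (cycle_graph 8) (complete_bipartite 3 (n - 3))"
      "num_copies (cycle_graph 6) (complete_bipartite 3 (n - 3))
        = ex_bip n (cycle_graph 6) (cycle_graph 8)"
      unfolding complete_bipartite_join ex_bip_hexagon_octagon
      by (simp_all add: card_image)
  qed
  show "num_copies (cycle_graph 6) G = ex_bip n (cycle_graph 6) (cycle_graph 8)
      \<longleftrightarrow> graph_iso G (complete_bipartite 3 (n - 3))"
    if "6 \<le> n" "bip_free_graph n (cycle_graph 8) G" for G :: "'a graph"
    unfolding ex_bip_hexagon_octagon by (rule extremal_iff[OF that])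
qed

end
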